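(* Let $\{v_j\}_{j=1}^k$ be a frame in $\mathbb{R}^n$ with (not necessarily optimal) frame bounds $0<A<B$. Then for every $\epsilon>0$ there exist vectors $\delta_1,\dots,\delta_k\in\mathbb{R}^n$ with $\|\delta_j\|<\epsilon$ for all $j$ such that $\{v_j+\delta_j\}_{j=1}^k$ is a frame in $\mathbb{R}^n$ with frame constants $0<A_1\le B_1$ satisfying $$\frac{B_1}{A_1}<\frac{B}{A}.$$
   Context: A finite family $\{x_j\}_{j=1}^k$ of vectors (repetitions allowed) in $\mathbb{R}^n$ is a frame with frame bounds (frame constants) $0<A\le B<\infty$ if $A\|x\|^2\le \sum_{j=1}^k|\langle x,x_j\rangle|^2\le B\|x\|^2$ for all $x\in\mathbb{R}^n$. The norm and inner product are the Euclidean ones. Frame bounds need not be optimal. *)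

theory Defs
  imports "HOL-Analysis.Analysis"
begin

text \<open>The family is \<open>x 1, \<dots>, x k\<close>, repetitions allowed; values of \<open>x\<close> outside \<open>{1..k}\<close>
  are irrelevant. The bounds need not be optimal.\<close>

definition frame_with_bounds :: "nat \<Rightarrow> (nat \<Rightarrow> real ^ 'n) \<Rightarrow> real \<Rightarrow> real \<Rightarrow> bool" where
  "frame_with_bounds k x A B \<longleftrightarrow>
     0 < A \<and> A \<le> B \<and>
     (\<forall>y. A * (norm y)\<^sup>2 \<le> (\<Sum>j=1..k. \<bar>y \<bullet> x j\<bar>\<^sup>2) \<and>
          (\<Sum>j=1..k. \<bar>y \<bullet> x j\<bar>\<^sup>2) \<le> B * (norm y)\<^sup>2)"

end

theory Submission
  imports Defs
begin

text \<open>Let \<open>S\<close> be the frame operator, so \<open>A \<le> S \<le> B\<close>. Moving each vector by \<open>\<delta> j = - t S (v j)\<close>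
  replaces \<open>S\<close> by \<open>p(S)\<close> with \<open>p(\<lambda>) = \<lambda> (1 - t \<lambda>)\<^sup>2\<close>. For small \<open>t > 0\<close> the polynomial \<open>p\<close> is
  increasing on \<open>[A, B]\<close>, so \<open>p(A)\<close> and \<open>p(B)\<close> are frame bounds, and their ratio is
  \<open>B / A\<close> times \<open>((1 - t B) / (1 - t A))\<^sup>2 < 1\<close>. The spectral theorem is avoided: the bounds
  \<open>p(A) \<le> p(S) \<le> p(B)\<close> follow from \<open>(S - A) (B - S) \<ge> 0\<close> and \<open>(S - B)\<^sup>2 \<ge> 0\<close>.\<close>

definition frame_operator :: "nat \<Rightarrow> (nat \<Rightarrow> 'a::real_inner) \<Rightarrow> 'a \<Rightarrow> 'a" where
  "frame_operator k v y = (\<Sum>j=1..k. (y \<bullet> v j) *\<^sub>R v j)"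

lemma linear_frame_operator: "linear (frame_operator k v)"
  unfolding frame_operator_def
  by (rule linearI)
    (simp_all add: inner_add_left scaleR_add_left sum.distrib scaleR_sum_right)

lemma frame_operator_self_adjoint: "frame_operator k v x \<bullet> y = x \<bullet> frame_operator k v y"
  by (simp add: frame_operator_def inner_sum_left inner_sum_right inner_commute mult.commute)

lemma inner_frame_operator: "y \<bullet> frame_operator k v y = (\<Sum>j=1..k. \<bar>y \<bullet> v j\<bar>\<^sup>2)"
  by (simp add: frame_operator_def inner_sum_right power2_eq_square)

text \<open>Expresses A \<le> S \<le> B through the quadratic form, so that the bounds can be
  applied at any vector, in particular at \<open>S y\<close>.\<close>

locale bounded_form =
  fixes S :: "'a::real_inner \<Rightarrow> 'a" and A B :: real
  assumes lin: "linear S"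
    and self_adjoint: "S x \<bullet> y = x \<bullet> S y"
    and lower: "A * (norm y)\<^sup>2 \<le> y \<bullet> S y"
    and upper: "y \<bullet> S y \<le> B * (norm y)\<^sup>2"
    and A_pos: "0 < A" and A_less_B: "A < B"
begin

text \<open>This is \<open>(S - A) (B - S) \<ge> 0\<close>. Writing \<open>P = S - A\<close>, it is the nonnegativity of \<open>P\<close> at
  \<open>y - P y / (B - A)\<close> combined with \<open>P \<le> B - A\<close> at \<open>P y\<close>.\<close>

lemma norm_sq_le: "(norm (S y))\<^sup>2 \<le> (A + B) * (y \<bullet> S y) - A * B * (norm y)\<^sup>2"
proof -
  define r where "r = B - A"
  have r: "r > 0" using A_less_B by (simp add: r_def)
  define P where "P x = S x - A *\<^sub>R x" for x
  have linP: "linear P"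
    unfolding P_def by (intro linear_compose_sub lin linear_scale_self)
  have saP: "P x \<bullet> z = x \<bullet> P z" for x z
    by (simp add: P_def inner_diff_left inner_diff_right self_adjoint)
  have P_nonneg: "0 \<le> x \<bullet> P x" and P_le: "x \<bullet> P x \<le> r * (norm x)\<^sup>2" for x
    using lower[of x] upper[of x]
    by (simp_all add: P_def r_def inner_diff_right power2_norm_eq_inner algebra_simps)
  have "0 \<le> (r *\<^sub>R y - P y) \<bullet> P (r *\<^sub>R y - P y)" by (rule P_nonneg)
  also have "\<dots> = r\<^sup>2 * (y \<bullet> P y) - 2 * r * (norm (P y))\<^sup>2 + P y \<bullet> P (P y)"
    using saP[of y "P y"]
    by (simp add: linear_diff[OF linP] linear_scale[OF linP] inner_diff_left inner_diff_right
        power2_norm_eq_inner power2_eq_square[of r] algebra_simps)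
  also have "\<dots> \<le> r\<^sup>2 * (y \<bullet> P y) - 2 * r * (norm (P y))\<^sup>2 + r * (norm (P y))\<^sup>2"
    using P_le[of "P y"] by simp
  also have "\<dots> = r * (r * (y \<bullet> P y) - (norm (P y))\<^sup>2)"
    by (simp add: algebra_simps power2_eq_square)
  finally have "(norm (P y))\<^sup>2 \<le> r * (y \<bullet> P y)"
    using r by (simp add: zero_le_mult_iff)
  then show ?thesis
    by (simp add: P_def r_def power2_norm_eq_inner inner_diff_left inner_diff_right
        inner_commute algebra_simps)
qed

text \<open>Expand the square. In spectral terms this is the tangent to \<lambda>^2 at B, whereas
  \<open>norm_sq_le\<close> is the chord over [A, B].\<close>

lemma norm_sq_ge: "2 * B * (y \<bullet> S y) - B\<^sup>2 * (norm y)\<^sup>2 \<le> (norm (S y))\<^sup>2"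
proof -
  have "0 \<le> (norm (S y - B *\<^sub>R y))\<^sup>2" by simp
  then show ?thesis
    by (simp add: power2_norm_eq_inner inner_diff_left inner_diff_right inner_commute
        power2_eq_square[of B] algebra_simps)
qed

text \<open>Keeping the cubic term as the form at \<open>S y\<close> lets \<open>lower\<close> and
  \<open>upper\<close> reduce it to a multiple of \<open>(norm (S y))\<^sup>2\<close>.\<close>

lemma form_shift_eq:
  "(y - t *\<^sub>R S y) \<bullet> S (y - t *\<^sub>R S y)
     = y \<bullet> S y - 2 * t * (norm (S y))\<^sup>2 + t\<^sup>2 * (S y \<bullet> S (S y))"
  using self_adjoint[of y "S y"]
  by (simp add: linear_diff[OF lin] linear_scale[OF lin] inner_diff_left inner_diff_right
      power2_norm_eq_inner power2_eq_square[of t] algebra_simps)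

text \<open>Once \<open>lower\<close> bounds the cubic term, \<open>(norm (S y))\<^sup>2\<close> has
  coefficient -s. The chord bound then leaves an expression linear in the form, to which
  \<open>lower\<close> applies again. All these bounds are exact on eigenvectors for A, hence the
  constant p(A).\<close>

lemma form_shift_lower:
  assumes t: "0 \<le> t" "4 * t * B \<le> 1"
  shows "A * (1 - t * A)\<^sup>2 * (norm y)\<^sup>2 \<le> (y - t *\<^sub>R S y) \<bullet> S (y - t *\<^sub>R S y)"
proof -
  define s where "s = 2 * t - t\<^sup>2 * A"
  have tA: "t * A \<le> t * B" using t A_less_B by (intro mult_left_mono) auto
  have s_nonneg: "0 \<le> s"
  proof -
    have "0 \<le> t * (2 - t * A)" using t tA by (intro mult_nonneg_nonneg) linarith+
    then show ?thesis by (simp add: s_def power2_eq_square algebra_simps)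
  qed
  \<comment> \<open>The form will carry the coefficient 1 - s (A + B); the smallness of t makes it
    nonnegative, since 2 t (A + B) \<le> 4 t B.\<close>
  have "s * (A + B) \<le> 2 * t * (A + B)"
    using A_pos A_less_B by (intro mult_right_mono) (auto simp: s_def)
  also have "\<dots> \<le> 1" using tA t by (simp add: algebra_simps)
  finally have s_le: "0 \<le> 1 - s * (A + B)" by simp
  have "A * (1 - t * A)\<^sup>2 * (norm y)\<^sup>2
      = (1 - s * (A + B)) * (A * (norm y)\<^sup>2) + s * A * B * (norm y)\<^sup>2"
    by (simp add: s_def power2_eq_square algebra_simps)
  also have "\<dots> \<le> (1 - s * (A + B)) * (y \<bullet> S y) + s * A * B * (norm y)\<^sup>2"
    by (intro add_right_mono mult_left_mono lower s_le)
  also have "\<dots> = y \<bullet> S y - s * ((A + B) * (y \<bullet> S y) - A * B * (norm y)\<^sup>2)"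
    by (simp add: algebra_simps)
  also have "\<dots> \<le> y \<bullet> S y - s * (norm (S y))\<^sup>2"
    by (intro diff_left_mono mult_left_mono norm_sq_le s_nonneg)
  also have "\<dots> = y \<bullet> S y - 2 * t * (norm (S y))\<^sup>2 + t\<^sup>2 * (A * (norm (S y))\<^sup>2)"
    by (simp add: s_def algebra_simps)
  also have "\<dots> \<le> y \<bullet> S y - 2 * t * (norm (S y))\<^sup>2 + t\<^sup>2 * (S y \<bullet> S (S y))"
    by (intro add_left_mono mult_left_mono lower) simp
  finally show ?thesis by (simp only: form_shift_eq)
qed

text \<open>Here \<open>(norm (S y))\<^sup>2\<close> must be bounded from below, and the tangent at
  B serves: it is exact on eigenvectors for B, hence the constant p(B).\<close>

lemma form_shift_upper:
  assumes t: "0 \<le> t" "4 * t * B \<le> 1"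
  shows "(y - t *\<^sub>R S y) \<bullet> S (y - t *\<^sub>R S y) \<le> B * (1 - t * B)\<^sup>2 * (norm y)\<^sup>2"
proof -
  define s where "s = 2 * t - t\<^sup>2 * B"
  have B_pos: "0 < B" using A_pos A_less_B by simp
  have s_nonneg: "0 \<le> s"
  proof -
    have "0 \<le> t * (2 - t * B)" using t by (intro mult_nonneg_nonneg) linarith+
    then show ?thesis by (simp add: s_def power2_eq_square algebra_simps)
  qed
  have "s * B \<le> 2 * t * B"
    using B_pos by (intro mult_right_mono) (auto simp: s_def)
  then have s_le: "0 \<le> 1 - 2 * (s * B)" using t by linarith
  have "(y - t *\<^sub>R S y) \<bullet> S (y - t *\<^sub>R S y)
      = y \<bullet> S y - 2 * t * (norm (S y))\<^sup>2 + t\<^sup>2 * (S y \<bullet> S (S y))"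
    by (rule form_shift_eq)
  also have "\<dots> \<le> y \<bullet> S y - 2 * t * (norm (S y))\<^sup>2 + t\<^sup>2 * (B * (norm (S y))\<^sup>2)"
    by (intro add_left_mono mult_left_mono upper) simp
  also have "\<dots> = y \<bullet> S y - s * (norm (S y))\<^sup>2"
    by (simp add: s_def algebra_simps)
  also have "\<dots> \<le> y \<bullet> S y - s * (2 * B * (y \<bullet> S y) - B\<^sup>2 * (norm y)\<^sup>2)"
    by (intro diff_left_mono mult_left_mono norm_sq_ge s_nonneg)
  also have "\<dots> = (1 - 2 * (s * B)) * (y \<bullet> S y) + s * B\<^sup>2 * (norm y)\<^sup>2"
    by (simp add: algebra_simps)
  also have "\<dots> \<le> (1 - 2 * (s * B)) * (B * (norm y)\<^sup>2) + s * B\<^sup>2 * (norm y)\<^sup>2"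
    by (intro add_right_mono mult_left_mono upper s_le)
  also have "\<dots> = B * (1 - t * B)\<^sup>2 * (norm y)\<^sup>2"
    by (simp add: s_def power2_eq_square algebra_simps)
  finally show ?thesis .
qed

end

theorem theorem1p2:
  fixes v :: "nat \<Rightarrow> real ^ 'n" and k :: nat and A B \<epsilon> :: real
  assumes "frame_with_bounds k v A B"
    and "0 < A" and "A < B"
    and "\<epsilon> > 0"
  shows "\<exists>\<delta> :: nat \<Rightarrow> real ^ 'n.
           (\<forall>j\<in>{1..k}. norm (\<delta> j) < \<epsilon>) \<and>
           (\<exists>A\<^sub>1 B\<^sub>1. 0 < A\<^sub>1 \<and> A\<^sub>1 \<le> B\<^sub>1 \<and>
              frame_with_bounds k (\<lambda>j. v j + \<delta> j) A\<^sub>1 B\<^sub>1 \<and>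
              B\<^sub>1 / A\<^sub>1 < B / A)"
proof -
  define S where "S = frame_operator k v"
  interpret bounded_form S A B
    using assms
    by (intro bounded_form.intro)
      (simp_all add: S_def linear_frame_operator frame_operator_self_adjoint
        inner_frame_operator frame_with_bounds_def)
  have B_pos: "0 < B" using assms by simp
  \<comment> \<open>The summand 1 makes M positive without a case distinction, so that \<epsilon>
    can be divided by it.\<close>
  define M where "M = 1 + (\<Sum>j=1..k. norm (S (v j)))"
  have M_pos: "0 < M" by (simp add: M_def sum_nonneg add_pos_nonneg)
  have M_ge: "norm (S (v j)) \<le> M" if "j \<in> {1..k}" for j
    using member_le_sum[OF that, of "\<lambda>j. norm (S (v j))"] by (simp add: M_def)
  \<comment> \<open>The first term gives the smallness needed for the form bounds, the second keeps
    every \<open>\<delta> j\<close> below \<epsilon>.\<close>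
  define t where "t = min (1 / (4 * B)) (\<epsilon> / (2 * M))"
  have t_pos: "0 < t" using B_pos M_pos assms by (simp add: t_def)
  have "t \<le> 1 / (4 * B)" by (simp add: t_def)
  then have tB: "4 * t * B \<le> 1" using B_pos by (simp add: field_simps)
  have "t \<le> \<epsilon> / (2 * M)" by (simp add: t_def)
  then have "t * M \<le> \<epsilon> / 2" using M_pos by (simp add: field_simps)
  then have tM: "t * M < \<epsilon>" using assms by simp
  define \<delta> where "\<delta> j = - (t *\<^sub>R S (v j))" for j
  have \<delta>_small: "norm (\<delta> j) < \<epsilon>" if "j \<in> {1..k}" for j
    using le_less_trans[OF mult_left_mono[OF M_ge[OF that] less_imp_le[OF t_pos]] tM] t_pos
    by (simp add: \<delta>_def)
  \<comment> \<open>Self-adjointness moves the perturbation from \<open>v j\<close> to y: the inner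
    product of y with \<open>v j + \<delta> j\<close> is that of \<open>y - t *\<^sub>R S y\<close>
    with \<open>v j\<close>.\<close>
  have sum_eq: "(\<Sum>j=1..k. \<bar>y \<bullet> (v j + \<delta> j)\<bar>\<^sup>2) = (y - t *\<^sub>R S y) \<bullet> S (y - t *\<^sub>R S y)" for y
    using self_adjoint[of y]
    by (simp add: S_def inner_frame_operator \<delta>_def inner_diff_left inner_diff_right)
  define A\<^sub>1 where "A\<^sub>1 = A * (1 - t * A)\<^sup>2"
  define B\<^sub>1 where "B\<^sub>1 = B * (1 - t * B)\<^sup>2"
  have tAB: "t * A < t * B" using t_pos assms by simp
  have A1_pos: "0 < A\<^sub>1" using assms tAB tB by (simp add: A\<^sub>1_def)
  have frame: "A\<^sub>1 * (norm y)\<^sup>2 \<le> (\<Sum>j=1..k. \<bar>y \<bullet> (v j + \<delta> j)\<bar>\<^sup>2)"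
    "(\<Sum>j=1..k. \<bar>y \<bullet> (v j + \<delta> j)\<bar>\<^sup>2) \<le> B\<^sub>1 * (norm y)\<^sup>2" for y
    using form_shift_lower[of t y] form_shift_upper[of t y] t_pos tB
    by (simp_all only: sum_eq A\<^sub>1_def B\<^sub>1_def less_imp_le)
  have A1_le_B1: "A\<^sub>1 \<le> B\<^sub>1"
  proof -
    \<comment> \<open>Comparing the two frame inequalities at a unit vector replaces a proof that p
      is increasing.\<close>
    obtain b :: "real ^ 'n" where "norm b = 1" using vector_choose_size[of 1] by auto
    then show ?thesis using frame[of b] by simp
  qed
  \<comment> \<open>Squaring preserves the order because t B \<le> 1/4 keeps both bases
    positive.\<close>
  have "(1 - t * B)\<^sup>2 < (1 - t * A)\<^sup>2"
    using tAB tB by (intro power_strict_mono) auto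
  then have "A * B * (1 - t * B)\<^sup>2 < A * B * (1 - t * A)\<^sup>2"
    using assms B_pos by simp
  then have "B\<^sub>1 * A < B * A\<^sub>1" by (simp add: A\<^sub>1_def B\<^sub>1_def mult_ac)
  then have "B\<^sub>1 / A\<^sub>1 < B / A"
    using A1_pos assms by (simp add: divide_less_eq less_divide_eq mult_ac)
  moreover have "frame_with_bounds k (\<lambda>j. v j + \<delta> j) A\<^sub>1 B\<^sub>1"
    using A1_pos A1_le_B1 frame by (simp add: frame_with_bounds_def)
  ultimately show ?thesis
    using \<delta>_small A1_pos A1_le_B1 by blast
qed

end
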